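(* In the planar four-body problem there are no central configurations with positive masses at the vertices of a parallelogram, excluding squares and rhombi. That is, if four positive masses at the vertices of a parallelogram form a central configuration, then the parallelogram is a rhombus (possibly a square).
   Context: A configuration $(q_1,\dots,q_4)$ of pairwise distinct points of $\mathbb{R}^2$ with positive masses $m_1,\dots,m_4$ is a central configuration if there is $\lambda>0$ with $\sum_{j\ne k} m_j\,(q_j-q_k)/\|q_j-q_k\|^3=-\lambda\,(q_k-\mathbf{c})$ for all $k$, where $\mathbf{c}=\sum m_kq_k/\sum m_k$. A parallelogram is a non-degenerate convex quadrilateral with two pairs of parallel sides; a rhombus is a parallelogram with four sides of equal length. *)

theory Defs
  imports "HOL-Analysis.Analysis"
begin

definition center_of_mass :: "('i::finite \<Rightarrow> real) \<Rightarrow> ('i \<Rightarrow> real^2) \<Rightarrow> real^2" where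
  "center_of_mass m q = (1 / (\<Sum>k\<in>UNIV. m k)) *\<^sub>R (\<Sum>k\<in>UNIV. m k *\<^sub>R q k)"

definition central_configuration :: "('i::finite \<Rightarrow> real) \<Rightarrow> ('i \<Rightarrow> real^2) \<Rightarrow> bool" where
  "central_configuration m q \<longleftrightarrow>
     inj q \<and>
     (\<exists>l>0. \<forall>k.
        (\<Sum>j\<in>UNIV - {k}. (m j / norm (q j - q k) ^ 3) *\<^sub>R (q j - q k))
          = - l *\<^sub>R (q k - center_of_mass m q))"

text \<open>Vertices are listed in cyclic order, so the sides are \<open>AB\<close>, \<open>BC\<close>, \<open>CD\<close>, \<open>DA\<close>.
  Non-degenerate: no three vertices are collinear (in particular they are pairwise distinct).
  Convex: the four sides are edges of the convex hull of the vertices, which rules out both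
  reflex vertices and self-crossing vertex orders.\<close>

definition convex_quadrilateral :: "real^2 \<Rightarrow> real^2 \<Rightarrow> real^2 \<Rightarrow> real^2 \<Rightarrow> bool" where
  "convex_quadrilateral A B C D \<longleftrightarrow>
     \<not> collinear {A, B, C} \<and> \<not> collinear {B, C, D} \<and>
     \<not> collinear {C, D, A} \<and> \<not> collinear {D, A, B} \<and>
     closed_segment A B edge_of convex hull {A, B, C, D} \<and>
     closed_segment B C edge_of convex hull {A, B, C, D} \<and>
     closed_segment C D edge_of convex hull {A, B, C, D} \<and>
     closed_segment D A edge_of convex hull {A, B, C, D}"

definition parallelogram :: "real^2 \<Rightarrow> real^2 \<Rightarrow> real^2 \<Rightarrow> real^2 \<Rightarrow> bool" where
  "parallelogram A B C D \<longleftrightarrow>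
     convex_quadrilateral A B C D \<and>
     affine_parallel (affine hull {A, B}) (affine hull {C, D}) \<and>
     affine_parallel (affine hull {B, C}) (affine hull {D, A})"

definition rhombus :: "real^2 \<Rightarrow> real^2 \<Rightarrow> real^2 \<Rightarrow> real^2 \<Rightarrow> bool" where
  "rhombus A B C D \<longleftrightarrow>
     parallelogram A B C D \<and>
     dist A B = dist B C \<and> dist B C = dist C D \<and> dist C D = dist D A"

end

theory Submission imports Defs begin

text \<open>
  The centre of mass is an average of the positions, so the right-hand side of the equations of a
  central configuration can be moved into the sum: each pair of bodies then interacts by the force
  law \<open>g r = 1 / r ^ 3 - l / M\<close>, with \<open>M\<close> the total mass, and all forces balance. At the vertex
  \<open>A\<close> of a parallelogram \<open>ABCD\<close> the pull of the diagonal body \<open>C\<close> has equal components along both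
  sides, which forces \<open>m B * g (AB) = m D * g (BC)\<close>; at \<open>C\<close>, likewise,
  \<open>m B * g (BC) = m D * g (AB)\<close>. Adding up, \<open>g (AB) = g (BC)\<close>, and \<open>g\<close> is injective.
\<close>

text \<open>The summand \<open>Q = P\<close> vanishes, whatever \<open>g 0\<close> is.\<close>

definition equilibrium :: "(real \<Rightarrow> real) \<Rightarrow> ('a::real_normed_vector \<Rightarrow> real) \<Rightarrow> 'a set \<Rightarrow> bool" where
  "equilibrium g w X \<longleftrightarrow> (\<forall>P\<in>X. (\<Sum>Q\<in>X. (w Q * g (dist Q P)) *\<^sub>R (Q - P)) = 0)"

lemma sum_scaleR_diff_center_of_mass:
  fixes m :: "'i::finite \<Rightarrow> real" and q :: "'i \<Rightarrow> real^2"
  assumes "sum m UNIV \<noteq> 0"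
  shows "(\<Sum>j\<in>UNIV. m j *\<^sub>R (q j - P)) = sum m UNIV *\<^sub>R (center_of_mass m q - P)"
  using assms
  by (simp add: center_of_mass_def scaleR_diff_right sum_subtractf scaleR_sum_left)

lemma central_configuration_imp_equilibrium:
  fixes m :: "'i::finite \<Rightarrow> real" and q :: "'i \<Rightarrow> real^2"
  assumes central: "central_configuration m q" and mass: "sum m UNIV \<noteq> 0"
  obtains \<mu> where "equilibrium (\<lambda>r. 1 / r ^ 3 - \<mu>) (m \<circ> inv q) (range q)"
proof -
  obtain l where inj: "inj q"
    and force: "\<And>k. (\<Sum>j\<in>UNIV - {k}. (m j / norm (q j - q k) ^ 3) *\<^sub>R (q j - q k))
      = - l *\<^sub>R (q k - center_of_mass m q)"
    using central unfolding central_configuration_def by blast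
  define \<mu> where "\<mu> = l / sum m UNIV"
  have balance: "(\<Sum>j\<in>UNIV. (m j * (1 / dist (q j) (q k) ^ 3 - \<mu>)) *\<^sub>R (q j - q k)) = 0" for k
  proof -
    have "(\<Sum>j\<in>UNIV. (m j / dist (q j) (q k) ^ 3) *\<^sub>R (q j - q k))
        = l *\<^sub>R (center_of_mass m q - q k)"
      using force[of k] by (simp add: sum.remove[of UNIV k] dist_norm algebra_simps)
    also have "\<dots> = \<mu> *\<^sub>R (\<Sum>j\<in>UNIV. m j *\<^sub>R (q j - q k))"
      using mass by (simp add: sum_scaleR_diff_center_of_mass \<mu>_def)
    finally show ?thesis
      by (simp add: right_diff_distrib scaleR_diff_left sum_subtractf scaleR_sum_right mult.commute)
  qed
  have "equilibrium (\<lambda>r. 1 / r ^ 3 - \<mu>) (m \<circ> inv q) (range q)"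
    using balance by (simp add: equilibrium_def sum.reindex[OF inj] inv_f_f[OF inj])
  then show thesis by (rule that)
qed

lemma not_collinear_sides_combination_eq_0_iff:
  fixes A B C :: "'a::real_vector"
  assumes "\<not> collinear {A, B, C}"
  shows "x *\<^sub>R (B - A) + y *\<^sub>R (C - B) = 0 \<longleftrightarrow> x = 0 \<and> y = 0"
proof
  assume "x *\<^sub>R (B - A) + y *\<^sub>R (C - B) = 0"
  then have parallel: "y *\<^sub>R (C - B) = x *\<^sub>R (A - B)"
    by (simp add: algebra_simps)
  have noncollinear: "\<not> collinear {0, A - B, C - B}"
    using assms collinear_3[of A B C] by simp
  have "y = 0"
  proof (rule ccontr)
    assume "y \<noteq> 0"
    then have "C - B = (x / y) *\<^sub>R (A - B)"
      using arg_cong[OF parallel, of "\<lambda>w. (1 / y) *\<^sub>R w"] by simp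
    with noncollinear show False by (auto simp: collinear_lemma)
  qed
  with parallel noncollinear show "x = 0 \<and> y = 0" by (auto simp: collinear_lemma)
qed simp

lemma dist_opposite_sides:
  fixes A B C D :: "'a::real_normed_vector"
  assumes "B - A = C - D"
  shows "dist A B = dist C D" "dist B C = dist D A"
proof -
  have "C - B = D - A"
    using assms by (simp add: algebra_simps)
  with assms show "dist A B = dist C D" "dist B C = dist D A"
    by (metis dist_norm dist_commute)+
qed

lemma equilibrium_parallelogram_vertex:
  fixes A B C D :: "'a::real_normed_vector"
  assumes noncollinear: "\<not> collinear {A, B, C}" and opposite_sides: "B - A = C - D"
    and balanced: "equilibrium g w {A, B, C, D}"
  shows "w B * g (dist A B) = w D * g (dist A D)"
proof -
  note independent = not_collinear_sides_combination_eq_0_iff[OF noncollinear]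
  have side_AD: "D - A = C - B" and diagonal_AC: "C - A = (B - A) + (C - B)"
    using opposite_sides by (simp_all add: algebra_simps)
  have "A \<noteq> B" "A \<noteq> C" "B \<noteq> C"
    using noncollinear by (auto simp: insert_commute)
  moreover have "B \<noteq> D"
    using independent[of 1 "-1"] opposite_sides by auto
  ultimately have "A \<notin> {B, C, D}" "B \<notin> {C, D}" "C \<noteq> D"
    using side_AD opposite_sides by auto
  then have "(w B * g (dist A B)) *\<^sub>R (B - A) + (w C * g (dist A C)) *\<^sub>R (C - A)
      + (w D * g (dist A D)) *\<^sub>R (D - A) = 0"
    using balanced by (simp add: equilibrium_def dist_commute add.assoc)
  then have "(w B * g (dist A B) + w C * g (dist A C)) *\<^sub>R (B - A)
      + (w C * g (dist A C) + w D * g (dist A D)) *\<^sub>R (C - B) = 0"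
    unfolding diagonal_AC side_AD by (simp only: scaleR_add_left scaleR_add_right ac_simps)
  then show ?thesis
    unfolding independent by linarith
qed

lemma equilibrium_parallelogram_adjacent_sides:
  fixes A B C D :: "'a::real_normed_vector"
  assumes noncollinear: "\<not> collinear {A, B, C}" and opposite_sides: "B - A = C - D"
    and balanced: "equilibrium g w {A, B, C, D}" and mass: "w B + w D \<noteq> 0"
  shows "g (dist A B) = g (dist B C)"
proof -
  have sides: "dist A D = dist B C" "dist C D = dist A B"
    using dist_opposite_sides[OF opposite_sides] by (simp_all add: dist_commute)
  have "w B * g (dist A B) = w D * g (dist B C)"
    using equilibrium_parallelogram_vertex[OF noncollinear opposite_sides balanced]
    by (simp add: sides)
  moreover have "w B * g (dist B C) = w D * g (dist A B)"
    using equilibrium_parallelogram_vertex[of C B A D g w] noncollinear opposite_sides balanced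
    by (simp add: sides dist_commute insert_commute algebra_simps)
  ultimately have "(w B + w D) * (g (dist A B) - g (dist B C)) = 0"
    by (simp add: algebra_simps)
  with mass show ?thesis by simp
qed

lemma affine_parallel_lines_direction:
  fixes A B C D :: "'a::real_vector"
  assumes "affine_parallel (affine hull {A, B}) (affine hull {C, D})"
  obtains s where "D - C = s *\<^sub>R (B - A)"
proof -
  obtain w where w: "affine hull {C, D} = (+) w ` range (\<lambda>t. A + t *\<^sub>R (B - A))"
    using assms unfolding affine_parallel_def affine_hull_2_alt[of A B] by blast
  have "C \<in> affine hull {C, D}" "D \<in> affine hull {C, D}"
    by (simp_all add: hull_inc)
  then obtain c d where "C = w + (A + c *\<^sub>R (B - A))" "D = w + (A + d *\<^sub>R (B - A))"
    unfolding w by blast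
  then have "D - C = (d - c) *\<^sub>R (B - A)"
    by (simp add: scaleR_diff_left)
  then show thesis by (rule that)
qed

lemma parallelogram_imp_not_collinear:
  "parallelogram A B C D \<Longrightarrow> \<not> collinear {A, B, C}"
  by (simp add: parallelogram_def convex_quadrilateral_def)

lemma parallelogram_opposite_sides:
  assumes "parallelogram A B C D"
  shows "B - A = C - D"
proof -
  obtain s t where s: "D - C = s *\<^sub>R (B - A)" and t: "A - D = t *\<^sub>R (C - B)"
    using assms affine_parallel_lines_direction unfolding parallelogram_def by metis
  have "(B - A) + (C - B) + (D - C) + (A - D) = 0"
    by simp
  then have "(1 + s) *\<^sub>R (B - A) + (1 + t) *\<^sub>R (C - B) = 0"
    unfolding s t by (simp add: algebra_simps)
  then have "s = -1"
    using not_collinear_sides_combination_eq_0_iff[OF parallelogram_imp_not_collinear[OF assms]]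
    by auto
  with s show ?thesis by (simp add: algebra_simps)
qed

lemma rhombus_iff_adjacent_sides:
  assumes "parallelogram A B C D"
  shows "rhombus A B C D \<longleftrightarrow> dist A B = dist B C"
proof -
  have "dist A B = dist C D" "dist B C = dist D A"
    using dist_opposite_sides[OF parallelogram_opposite_sides[OF assms]] by simp_all
  with assms show ?thesis by (auto simp: rhombus_def)
qed

theorem proposition4:
  fixes m :: "4 \<Rightarrow> real" and q :: "4 \<Rightarrow> real^2" and A B C D :: "real^2"
  assumes "\<And>k. m k > 0"
    and "central_configuration m q"
    and "parallelogram A B C D"
    and "range q = {A, B, C, D}"
  shows "rhombus A B C D"
proof -
  have "sum m UNIV > 0"
    by (rule sum_pos) (auto simp: assms(1))
  then obtain \<mu> where "equilibrium (\<lambda>r. 1 / r ^ 3 - \<mu>) (m \<circ> inv q) {A, B, C, D}"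
    using central_configuration_imp_equilibrium[OF assms(2)] assms(4) by auto
  moreover have "(m \<circ> inv q) B + (m \<circ> inv q) D \<noteq> 0"
    using assms(1)[of "inv q B"] assms(1)[of "inv q D"] by simp
  ultimately have "1 / dist A B ^ 3 - \<mu> = 1 / dist B C ^ 3 - \<mu>"
    by (rule equilibrium_parallelogram_adjacent_sides
        [OF parallelogram_imp_not_collinear parallelogram_opposite_sides, OF assms(3,3)])
  then have "dist A B = dist B C"
    by (simp add: power_eq_iff_eq_base)
  then show ?thesis
    using rhombus_iff_adjacent_sides[OF assms(3)] by simp
qed

end
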